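(* Let $R$ be a complex rational map of degree $d\ge 2$ on the Riemann sphere $\widehat{\mathbb{C}}$. There exists $N\in\mathbb{N}_0$ such that for all $z_0,w_0\in\widehat{\mathbb{C}}$, writing $z_n=R^n(z_0)$ and $w_n=R^n(w_0)$: if $d_{FS}(0,z_n)=d_{FS}(0,w_n)$ for all $0\le n\le N$, then $d_{FS}(0,z_n)=d_{FS}(0,w_n)$ for every $n\in\mathbb{N}_0$.
   Context: $R^n$ denotes the $n$-th iterate of $R$ (with $R^0$ the identity). For $z\in\mathbb{C}$ put $d_{FS}(0,z)=\frac{2}{\pi}\arccos\sqrt{\frac{1}{1+|z|^2}}$ and put $d_{FS}(0,\infty)=1$ (normalized Fubini-Study distance to the origin on $\widehat{\mathbb{C}}=\mathbb{CP}^1$); thus $d_{FS}(0,z)=d_{FS}(0,w)$ if and only if $|z|=|w|$ (with $|\infty|=\infty$). *)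

theory Defs
  imports Complex_Main "HOL-Computational_Algebra.Polynomial"
begin

(* The point at infinity is None, as in the library's Alexandroff_compactification. *)
type_synonym riemann_sphere = "complex option"

(* In homogeneous coordinates, with d = max (degree p) (degree q), the quotient p/q acts by
   [z : w] |-> [w^d p(z/w) : w^d q(z/w)]. At infinity = [1 : 0] the two homogenized
   polynomials take the values coeff p d and coeff q d. *)
definition quotient_map :: "complex poly \<Rightarrow> complex poly \<Rightarrow> riemann_sphere \<Rightarrow> riemann_sphere" where
  "quotient_map p q x =
     (case x of
        Some z \<Rightarrow> if poly q z = 0 then None else Some (poly p z / poly q z)
      | None \<Rightarrow>
          let d = max (degree p) (degree q)
          in if coeff q d = 0 then None else Some (coeff p d / coeff q d))"

definition rational_map_of_degree :: "nat \<Rightarrow> (riemann_sphere \<Rightarrow> riemann_sphere) \<Rightarrow> bool" where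
  "rational_map_of_degree d R \<longleftrightarrow>
     (\<exists>p q. q \<noteq> 0 \<and> coprime p q \<and> max (degree p) (degree q) = d \<and> R = quotient_map p q)"

definition d_FS_origin :: "riemann_sphere \<Rightarrow> real" where
  "d_FS_origin x =
     (case x of
        Some z \<Rightarrow> 2 / pi * arccos (sqrt (1 / (1 + (cmod z)\<^sup>2)))
      | None \<Rightarrow> 1)"

end

theory Submission
  imports Defs "HOL-Library.Function_Algebras" "HOL-Library.Product_Plus"
begin

text \<open>
  In homogeneous coordinates the iterates of \<open>R\<close> are polynomial, so \<open>|z\<^sub>n| = |w\<^sub>n|\<close> says that a
  polynomial \<open>f\<^sub>n\<close> in the coordinates of \<open>z\<^sub>0\<close> and \<open>w\<^sub>0\<close> and their complex conjugates vanishes.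
  The ideals of all such polynomials vanishing on the common zeros of \<open>f\<^sub>0, \<dots>, f\<^sub>n\<close> increase with \<open>n\<close>,
  hence are constant from some \<open>N\<close> on by Hilbert's basis theorem, and every \<open>f\<^sub>n\<close> then vanishes on
  the common zeros of \<open>f\<^sub>0, \<dots>, f\<^sub>N\<close>.
\<close>

section \<open>Hilbert's basis theorem for subrings of a fixed commutative ring\<close>

definition is_subring :: "'a::comm_ring_1 set \<Rightarrow> bool" where
  "is_subring A \<longleftrightarrow> 1 \<in> A \<and> (\<forall>a\<in>A. \<forall>b\<in>A. a - b \<in> A) \<and> (\<forall>a\<in>A. \<forall>b\<in>A. a * b \<in> A)"

definition is_ideal :: "'a::comm_ring_1 set \<Rightarrow> 'a set \<Rightarrow> bool" where
  "is_ideal A I \<longleftrightarrow> I \<subseteq> A \<and> 0 \<in> I \<and> (\<forall>a\<in>I. \<forall>b\<in>I. a - b \<in> I) \<and> (\<forall>r\<in>A. \<forall>a\<in>I. r * a \<in> I)"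

text \<open>The ascending chain condition. Rings are carrier sets rather than types because the ring
  finally used is a ring of functions that grows by adjoining one function at a time.\<close>

definition noetherian :: "'a::comm_ring_1 set \<Rightarrow> bool" where
  "noetherian A \<longleftrightarrow>
     (\<forall>J :: nat \<Rightarrow> 'a set. incseq J \<longrightarrow> (\<forall>n. is_ideal A (J n)) \<longrightarrow> (\<exists>N. \<forall>n. J n \<subseteq> J N))"

text \<open>The ring \<open>A[g]\<close> as the image of \<open>A[X]\<close> under evaluation at
  \<open>g\<close>. Since \<open>g\<close> may satisfy relations over \<open>A\<close>, the
  polynomial representing an element need not be unique.\<close>

definition adjoin :: "'a::comm_ring_1 set \<Rightarrow> 'a \<Rightarrow> 'a set" where
  "adjoin A g = {poly p g | p. \<forall>i. coeff p i \<in> A}"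

lemma subring_closed:
  assumes "is_subring A"
  shows subring_1: "1 \<in> A"
    and subring_0: "0 \<in> A"
    and subring_diff: "\<And>a b. a \<in> A \<Longrightarrow> b \<in> A \<Longrightarrow> a - b \<in> A"
    and subring_add: "\<And>a b. a \<in> A \<Longrightarrow> b \<in> A \<Longrightarrow> a + b \<in> A"
    and subring_mult: "\<And>a b. a \<in> A \<Longrightarrow> b \<in> A \<Longrightarrow> a * b \<in> A"
proof -
  show one: "1 \<in> A" and diff: "\<And>a b. a \<in> A \<Longrightarrow> b \<in> A \<Longrightarrow> a - b \<in> A"
    and "\<And>a b. a \<in> A \<Longrightarrow> b \<in> A \<Longrightarrow> a * b \<in> A"
    using assms by (auto simp: is_subring_def)
  show zero: "0 \<in> A"
    using diff[OF one one] by simp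
  show "a + b \<in> A" if "a \<in> A" "b \<in> A" for a b
    using diff[OF that(1) diff[OF zero that(2)]] by simp
qed

lemma subring_sum:
  assumes "is_subring A" and "\<And>i. i \<in> I \<Longrightarrow> f i \<in> A"
  shows "sum f I \<in> A"
  using assms(2) by (induction I rule: infinite_finite_induct)
    (auto intro: subring_0 subring_add assms(1))

lemma subring_adjoin:
  assumes A: "is_subring A"
  shows "is_subring (adjoin A g)"
  unfolding is_subring_def
proof (intro conjI ballI)
  show "1 \<in> adjoin A g"
    unfolding adjoin_def using subring_0[OF A] subring_1[OF A]
    by (auto intro!: exI[of _ 1] simp: coeff_1)
next
  fix a b assume "a \<in> adjoin A g" "b \<in> adjoin A g"
  then obtain p q where pq: "a = poly p g" "b = poly q g"
    and mem: "\<And>i. coeff p i \<in> A" "\<And>i. coeff q i \<in> A"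
    unfolding adjoin_def by auto
  show "a - b \<in> adjoin A g"
    unfolding adjoin_def using pq mem subring_diff[OF A] by (auto intro!: exI[of _ "p - q"])
  have "coeff (p * q) i \<in> A" for i
    using mem by (auto simp: coeff_mult intro!: subring_sum[OF A] subring_mult[OF A])
  then show "a * b \<in> adjoin A g"
    unfolding adjoin_def using pq by (auto intro!: exI[of _ "p * q"])
qed

lemma adjoin_superset: "is_subring A \<Longrightarrow> A \<subseteq> adjoin A g"
proof
  fix a assume "is_subring A" "a \<in> A"
  then have "\<forall>i. coeff [:a:] i \<in> A"
    by (auto simp: coeff_pCons subring_0 split: nat.splits)
  then show "a \<in> adjoin A g"
    unfolding adjoin_def by (auto intro!: exI[of _ "[:a:]"])
qed

lemma adjoin_generator: "is_subring A \<Longrightarrow> g \<in> adjoin A g"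
  unfolding adjoin_def
  by (auto intro!: exI[of _ "[:0, 1:]"] simp: coeff_pCons subring_0 subring_1 split: nat.splits)

text \<open>The classical leading-coefficient ideal in degree \<open>m\<close>, taken for the
  preimage of \<open>I\<close> in \<open>A[X]\<close>. Asking only for degree at most
  \<open>m\<close> lets the coefficient be 0, so that differences stay inside.\<close>

definition leading_coeffs :: "'a::comm_ring_1 set \<Rightarrow> 'a \<Rightarrow> 'a set \<Rightarrow> nat \<Rightarrow> 'a set" where
  "leading_coeffs A g I m =
     {coeff p m | p. (\<forall>i. coeff p i \<in> A) \<and> degree p \<le> m \<and> poly p g \<in> I}"

lemma leading_coeffs_ideal:
  assumes A: "is_subring A" and I: "is_ideal (adjoin A g) I"
  shows "is_ideal A (leading_coeffs A g I m)"
  unfolding is_ideal_def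
proof (intro conjI ballI)
  show "leading_coeffs A g I m \<subseteq> A"
    by (auto simp: leading_coeffs_def)
  show "0 \<in> leading_coeffs A g I m"
    using I subring_0[OF A] by (auto simp: leading_coeffs_def is_ideal_def intro!: exI[of _ 0])
next
  fix a b assume "a \<in> leading_coeffs A g I m" "b \<in> leading_coeffs A g I m"
  then obtain p q where "a = coeff p m" "b = coeff q m" "degree p \<le> m" "degree q \<le> m"
    "poly p g \<in> I" "poly q g \<in> I" "\<And>i. coeff p i \<in> A" "\<And>i. coeff q i \<in> A"
    unfolding leading_coeffs_def by auto
  then show "a - b \<in> leading_coeffs A g I m"
    unfolding leading_coeffs_def using I subring_diff[OF A]
    by (auto intro!: exI[of _ "p - q"] degree_diff_le simp: is_ideal_def)
next
  fix r a assume r: "r \<in> A" and "a \<in> leading_coeffs A g I m"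
  then obtain p where p: "a = coeff p m" "degree p \<le> m" "poly p g \<in> I" "\<And>i. coeff p i \<in> A"
    unfolding leading_coeffs_def by auto
  have "r * poly p g \<in> I"
    using I p(3) r adjoin_superset[OF A, of g] by (auto simp: is_ideal_def)
  then show "r * a \<in> leading_coeffs A g I m"
    unfolding leading_coeffs_def using p r subring_mult[OF A]
    by (auto intro!: exI[of _ "smult r p"] order_trans[OF degree_smult_le])
qed

lemma leading_coeffs_mono: "I \<subseteq> I' \<Longrightarrow> leading_coeffs A g I m \<subseteq> leading_coeffs A g I' m"
  by (auto simp: leading_coeffs_def)

text \<open>Multiplying a polynomial by \<open>X\<close> shifts its coefficients up by one and
  multiplies its value at \<open>g\<close> by \<open>g\<close>, which keeps that value in
  \<open>I\<close>.\<close>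

lemma leading_coeffs_Suc:
  assumes A: "is_subring A" and I: "is_ideal (adjoin A g) I"
  shows "leading_coeffs A g I m \<subseteq> leading_coeffs A g I (Suc m)"
proof
  fix a assume "a \<in> leading_coeffs A g I m"
  then obtain p where p: "a = coeff p m" "degree p \<le> m" "poly p g \<in> I" "\<And>i. coeff p i \<in> A"
    unfolding leading_coeffs_def by auto
  have "g * poly p g \<in> I"
    using I p(3) adjoin_generator[OF A, of g] by (auto simp: is_ideal_def)
  moreover have "coeff (pCons 0 p) i \<in> A" for i
    using p(4) subring_0[OF A] by (auto simp: coeff_pCons split: nat.splits)
  ultimately show "a \<in> leading_coeffs A g I (Suc m)"
    unfolding leading_coeffs_def using p
    by (auto intro!: exI[of _ "pCons 0 p"] order_trans[OF degree_pCons_le])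
qed

text \<open>Reduction by degree: the top coefficient of a polynomial with value in \<open>I\<close>
  is matched by one of no larger degree with value in \<open>I'\<close>, and subtracting the latter
  lowers the degree.\<close>

lemma ideal_subset_if_leading_coeffs_subset:
  assumes A: "is_subring A"
    and I: "is_ideal (adjoin A g) I" and I': "is_ideal (adjoin A g) I'" and "I' \<subseteq> I"
    and lc: "\<And>m. leading_coeffs A g I m \<subseteq> leading_coeffs A g I' m"
  shows "I \<subseteq> I'"
proof -
  \<comment> \<open>The bound \<open>m\<close> is exclusive, so \<open>m = 0\<close> means that
    \<open>p\<close> is the zero polynomial; the degree alone would not separate it from the nonzero
    constants.\<close>
  have step: "poly p g \<in> I'"
    if "\<forall>i. coeff p i \<in> A" "poly p g \<in> I" "\<forall>i\<ge>m. coeff p i = 0" for m p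
    using that
  proof (induction m arbitrary: p)
    case 0
    then have "p = 0"
      by (simp add: poly_eq_iff)
    then show ?case
      using I' by (simp add: is_ideal_def)
  next
    case (Suc m)
    have "degree p \<le> m"
      using Suc.prems(3) by (intro degree_le) auto
    then have "coeff p m \<in> leading_coeffs A g I m"
      unfolding leading_coeffs_def using Suc.prems by auto
    then obtain q where q: "coeff p m = coeff q m" "degree q \<le> m" "poly q g \<in> I'"
      "\<And>i. coeff q i \<in> A"
      using subsetD[OF lc] unfolding leading_coeffs_def by blast
    have "poly (p - q) g \<in> I'"
    proof (rule Suc.IH)
      show "\<forall>i. coeff (p - q) i \<in> A"
        using Suc.prems(1) q(4) subring_diff[OF A] by simp
      show "poly (p - q) g \<in> I"
        using I Suc.prems(2) q(3) \<open>I' \<subseteq> I\<close> by (auto simp: is_ideal_def)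
      show "\<forall>i\<ge>m. coeff (p - q) i = 0"
        using Suc.prems(3) q(1,2)
        by (metis Suc_leI coeff_diff coeff_eq_0 diff_self le_neq_implies_less order_le_less_trans)
    qed
    \<comment> \<open>Ideals are given as closed under differences, so the sum of the values of
      \<open>p - q\<close> and \<open>q\<close> is written as a double difference.\<close>
    then have "(0 - poly q g) \<in> I'" "poly (p - q) g - (0 - poly q g) \<in> I'"
      using I' q(3) unfolding is_ideal_def by blast+
    then show ?case
      by simp
  qed
  show ?thesis
  proof
    fix a assume "a \<in> I"
    moreover from this obtain p where "a = poly p g" "\<forall>i. coeff p i \<in> A"
      using I unfolding is_ideal_def adjoin_def by blast
    ultimately show "a \<in> I'"
      using step[of p "Suc (degree p)"] by (auto simp: coeff_eq_0)
  qed
qed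

text \<open>The ideals \<open>L n m\<close> of leading coefficients increase in both indices.
  Stability of the diagonal from \<open>M\<close> on settles all degrees \<open>m \<ge> M\<close>;
  the finitely many degrees below \<open>M\<close> are each a chain in \<open>n\<close> and
  stabilise separately.\<close>

theorem hilbert_basis:
  assumes A: "is_subring A" and noeth: "noetherian A"
  shows "noetherian (adjoin A g)"
  unfolding noetherian_def
proof (intro allI impI)
  fix J :: "nat \<Rightarrow> 'a set"
  assume inc: "incseq J" and ideal: "\<forall>n. is_ideal (adjoin A g) (J n)"
  define L where "L n m = leading_coeffs A g (J n) m" for n m
  have L_ideal: "is_ideal A (L n m)" for n m
    unfolding L_def using leading_coeffs_ideal[OF A] ideal by blast
  have mono1: "L n m \<subseteq> L n' m" if "n \<le> n'" for n n' m
    unfolding L_def using incseqD[OF inc that] by (rule leading_coeffs_mono)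
  have mono2: "L n m \<subseteq> L n m'" if "m \<le> m'" for n m m'
    unfolding L_def
    by (rule lift_Suc_mono_le[of "leading_coeffs A g (J n)", OF leading_coeffs_Suc[OF A] that])
      (use ideal in blast)
  have "incseq (\<lambda>k. L k k)"
    using mono1 mono2 by (meson monoI order_trans)
  then obtain M where M: "\<And>k. L k k \<subseteq> L M M"
    using noeth L_ideal unfolding noetherian_def by blast
  have "\<exists>N. \<forall>n. L n m \<subseteq> L N m" for m
    using noeth L_ideal mono1 unfolding noetherian_def incseq_def by meson
  then obtain K where K: "\<And>n m. L n m \<subseteq> L (K m) m"
    by metis
  \<comment> \<open>The maximum of finitely many stages serves every degree at once.\<close>
  define N where "N = Max (insert M (K ` {..<M}))"
  have "M \<le> N" and N: "\<And>m. m < M \<Longrightarrow> K m \<le> N"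
    unfolding N_def by (auto intro!: Max_ge)
  have L_stable: "L n m \<subseteq> L N m" for n m
  proof (cases "m < M")
    case True
    then show ?thesis
      using K[of n m] mono1[OF N, of m] by blast
  next
    case False
    \<comment> \<open>Go up to the diagonal, down to its stable value at \<open>M\<close>, and back
      to degree \<open>m\<close>, which is possible because \<open>M \<le> m\<close>.\<close>
    have "L n m \<subseteq> L (max n m) (max n m)"
      using mono1[of n "max n m" m] mono2[of m "max n m" "max n m"] by auto
    also have "\<dots> \<subseteq> L M M"
      by (rule M)
    also have "\<dots> \<subseteq> L N m"
      using mono1[OF \<open>M \<le> N\<close>, of M] mono2[of M m N] False by auto
    finally show ?thesis .
  qed
  have "J n \<subseteq> J N" for n
  proof (cases "n \<le> N")
    case True
    then show ?thesis
      by (rule incseqD[OF inc])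
  next
    case False
    then have "J N \<subseteq> J n"
      by (intro incseqD[OF inc]) simp
    with A ideal[rule_format, of n] ideal[rule_format, of N] show ?thesis
      using L_stable unfolding L_def by (rule ideal_subset_if_leading_coeffs_subset)
  qed
  then show "\<exists>N. \<forall>n. J n \<subseteq> J N"
    by blast
qed

text \<open>An ideal with a nonzero element contains 1 and hence everything, so a chain is stable as
  soon as it leaves the zero ideal.\<close>

lemma noetherian_if_inverses:
  assumes "\<And>a. a \<in> K \<Longrightarrow> a \<noteq> 0 \<Longrightarrow> \<exists>b\<in>K. b * a = 1"
  shows "noetherian K"
  unfolding noetherian_def
proof (intro allI impI)
  fix J :: "nat \<Rightarrow> 'a set"
  assume ideal: "\<forall>n. is_ideal K (J n)"
  show "\<exists>N. \<forall>n. J n \<subseteq> J N"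
  proof (cases "\<forall>n. J n \<subseteq> {0}")
    case True
    then have "J n \<subseteq> J 0" for n
      using ideal by (auto simp: is_ideal_def)
    then show ?thesis
      by blast
  next
    case False
    then obtain N a where a: "a \<in> J N" "a \<noteq> 0"
      by auto
    have "a \<in> K"
      using a(1) ideal by (auto simp: is_ideal_def)
    then obtain b where "b \<in> K" "b * a = 1"
      using assms a(2) by blast
    then have "1 \<in> J N"
      using ideal a unfolding is_ideal_def by metis
    then have "K \<subseteq> J N"
      using ideal unfolding is_ideal_def by (metis mult.right_neutral subsetI)
    then show ?thesis
      using ideal unfolding is_ideal_def by blast
  qed
qed

text \<open>As \<open>n\<close> grows, the common zero set of \<open>f 0, ..., f n\<close> shrinks,
  so its vanishing ideal \<open>J n\<close> grows and stabilises. Each \<open>f n\<close> lies in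
  \<open>J n\<close>, hence in the stable ideal \<open>J N\<close>.\<close>

lemma zero_sets_stabilise:
  fixes f :: "nat \<Rightarrow> 'x \<Rightarrow> 'b::comm_ring_1"
  assumes A: "is_subring A" "noetherian A" and f: "\<And>n. f n \<in> A"
  shows "\<exists>N. \<forall>x. (\<forall>n\<le>N. f n x = 0) \<longrightarrow> (\<forall>n. f n x = 0)"
proof -
  define J where "J n = {a \<in> A. \<forall>x. (\<forall>k\<le>n. f k x = 0) \<longrightarrow> a x = 0}" for n
  have "incseq J"
    unfolding J_def incseq_def by (auto dest: order_trans)
  moreover have "is_ideal A (J n)" for n
    unfolding J_def is_ideal_def
    by (auto simp: subring_0[OF A(1)] subring_diff[OF A(1)] subring_mult[OF A(1)])
  ultimately obtain N where "\<And>n. J n \<subseteq> J N"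
    using A(2) unfolding noetherian_def by blast
  moreover have "f n \<in> J n" for n
    using f by (auto simp: J_def)
  ultimately have "f n \<in> J N" for n
    by blast
  then show ?thesis
    unfolding J_def by blast
qed

section \<open>Complex polynomial expressions in finitely many given functions\<close>

abbreviation polynomial_functions :: "('x \<Rightarrow> complex) list \<Rightarrow> ('x \<Rightarrow> complex) set" where
  "polynomial_functions gs \<equiv> foldr (\<lambda>g A. adjoin A g) gs (range (\<lambda>c x. c))"

lemma subring_polynomial_functions: "is_subring (polynomial_functions gs)"
proof (induction gs)
  case Nil
  show ?case
    by (auto simp: is_subring_def fun_eq_iff image_iff)
qed (simp add: subring_adjoin)

text \<open>The constant functions form a copy of the field of complex numbers, and each generator
  costs one application of the basis theorem.\<close>

lemma noetherian_polynomial_functions: "noetherian (polynomial_functions gs)"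
proof (induction gs)
  case Nil
  have "noetherian (range (\<lambda>c (x::'a). c :: complex))"
  proof (rule noetherian_if_inverses)
    fix a :: "'a \<Rightarrow> complex"
    assume "a \<in> range (\<lambda>c x. c)" "a \<noteq> 0"
    then obtain c where "a = (\<lambda>x. c)" "c \<noteq> 0"
      by (auto simp: fun_eq_iff)
    then show "\<exists>b\<in>range (\<lambda>c x. c). b * a = 1"
      by (intro bexI[of _ "\<lambda>x. 1 / c"]) (auto simp: fun_eq_iff)
  qed
  then show ?case
    by simp
qed (simp add: hilbert_basis subring_polynomial_functions)

lemma const_polynomial_function: "(\<lambda>x. c) \<in> polynomial_functions gs"
  by (induction gs) (auto intro: subsetD[OF adjoin_superset[OF subring_polynomial_functions]])

lemma generator_polynomial_function: "g \<in> set gs \<Longrightarrow> g \<in> polynomial_functions gs"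
  by (induction gs) (auto intro: adjoin_generator[OF subring_polynomial_functions]
      subsetD[OF adjoin_superset[OF subring_polynomial_functions]])

lemma mult_polynomial_function:
  "f \<in> polynomial_functions gs \<Longrightarrow> g \<in> polynomial_functions gs \<Longrightarrow>
    (\<lambda>x. f x * g x) \<in> polynomial_functions gs"
  using subring_mult[OF subring_polynomial_functions, of f gs g] by (simp add: times_fun_def)

lemma diff_polynomial_function:
  "f \<in> polynomial_functions gs \<Longrightarrow> g \<in> polynomial_functions gs \<Longrightarrow>
    (\<lambda>x. f x - g x) \<in> polynomial_functions gs"
  using subring_diff[OF subring_polynomial_functions, of f gs g] by (simp add: fun_diff_def)

lemma power_polynomial_function:
  "f \<in> polynomial_functions gs \<Longrightarrow> (\<lambda>x. f x ^ n) \<in> polynomial_functions gs"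
  by (induction n) (simp_all add: const_polynomial_function mult_polynomial_function)

lemma sum_polynomial_function:
  assumes "\<And>i. i \<in> I \<Longrightarrow> f i \<in> polynomial_functions gs"
  shows "(\<lambda>x. \<Sum>i\<in>I. f i x) \<in> polynomial_functions gs"
proof -
  have "(\<lambda>x. \<Sum>i\<in>I. f i x) = (\<Sum>i\<in>I. f i)"
    by (induction I rule: infinite_finite_induct) (auto simp: fun_eq_iff)
  then show ?thesis
    using subring_sum[OF subring_polynomial_functions, of I f gs] assms by simp
qed

lemmas polynomial_function_intros =
  const_polynomial_function mult_polynomial_function diff_polynomial_function
  power_polynomial_function sum_polynomial_function

section \<open>Lifting a rational map to homogeneous coordinates\<close>

definition homogenize :: "nat \<Rightarrow> complex poly \<Rightarrow> complex \<Rightarrow> complex \<Rightarrow> complex" where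
  "homogenize d p x y = (\<Sum>i\<le>d. coeff p i * x ^ i * y ^ (d - i))"

lemma homogenize_nonzero:
  assumes "degree p \<le> d" "y \<noteq> 0"
  shows "homogenize d p x y = y ^ d * poly p (x / y)"
proof -
  have "poly p (x / y) = (\<Sum>i\<le>d. coeff p i * (x / y) ^ i)"
    unfolding poly_altdef using assms(1)
    by (intro sum.mono_neutral_left) (auto simp: coeff_eq_0)
  then show ?thesis
    unfolding homogenize_def using assms(2)
    by (auto simp: sum_distrib_left power_diff power_divide intro!: sum.cong)
qed

lemma homogenize_0: "homogenize d p x 0 = coeff p d * x ^ d"
proof -
  \<comment> \<open>Only the term with \<open>i = d\<close> survives at \<open>y = 0\<close>,
    because its factor is \<open>0 ^ 0 = 1\<close>.\<close>
  have "homogenize d p x 0 = (\<Sum>i\<le>d. if i = d then coeff p d * x ^ d else 0)"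
    unfolding homogenize_def by (intro sum.cong) auto
  then show ?thesis
    by simp
qed

lemma homogenize_polynomial_function:
  assumes "f \<in> polynomial_functions gs" "g \<in> polynomial_functions gs"
  shows "(\<lambda>v. homogenize d p (f v) (g v)) \<in> polynomial_functions gs"
  unfolding homogenize_def by (intro polynomial_function_intros assms)

text \<open>Conjugation is not polynomial in \<open>x\<close> and \<open>y\<close>. Moving it to the
  coefficients and the arguments keeps the conjugate coordinates polynomial in the conjugates of the
  earlier ones.\<close>

lemma cnj_homogenize: "cnj (homogenize d p x y) = homogenize d (map_poly cnj p) (cnj x) (cnj y)"
  by (simp add: homogenize_def coeff_map_poly)

fun lift_to_C2 :: "riemann_sphere \<Rightarrow> complex \<times> complex" where
  "lift_to_C2 (Some z) = (z, 1)"
| "lift_to_C2 None = (1, 0)"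

definition project :: "complex \<times> complex \<Rightarrow> riemann_sphere" where
  "project v = (if snd v = 0 then None else Some (fst v / snd v))"

definition lifted_map ::
  "nat \<Rightarrow> complex poly \<Rightarrow> complex poly \<Rightarrow> complex \<times> complex \<Rightarrow> complex \<times> complex" where
  "lifted_map d p q v = (homogenize d p (fst v) (snd v), homogenize d q (fst v) (snd v))"

lemma project_lift: "project (lift_to_C2 z) = z" and lift_nonzero: "lift_to_C2 z \<noteq> 0"
  by (cases z; simp add: project_def zero_prod_def)+

lemma coprime_no_common_root:
  fixes p q :: "complex poly"
  assumes "coprime p q" "poly p z = 0"
  shows "poly q z \<noteq> 0"
proof
  assume "poly q z = 0"
  then have "is_unit [:- z, 1:]"
    using assms by (meson coprime_def poly_eq_0_iff_dvd)
  then show False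
    by (simp add: is_unit_iff_degree)
qed

text \<open>The two homogenized forms have no common zero except the origin: for
  \<open>y \<noteq> 0\<close> it would give a common root of \<open>p\<close> and \<open>q\<close>,
  and for \<open>y = 0\<close> one of the two has a nonzero coefficient at \<open>d\<close>.\<close>

lemma lifted_map_correct:
  assumes "coprime p q" "d = max (degree p) (degree q)" "q \<noteq> 0" "v \<noteq> 0"
  shows "lifted_map d p q v \<noteq> 0" "project (lifted_map d p q v) = quotient_map p q (project v)"
proof -
  obtain x y where v: "v = (x, y)"
    by fastforce
  have "lifted_map d p q v \<noteq> 0 \<and> project (lifted_map d p q v) = quotient_map p q (project v)"
  proof (cases "y = 0")
    case False
    then show ?thesis
      using coprime_no_common_root[OF assms(1), of "x / y"] assms(2)
      by (auto simp: v lifted_map_def project_def quotient_map_def homogenize_nonzero zero_prod_def)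
  next
    case True
    then have "x \<noteq> 0"
      using \<open>v \<noteq> 0\<close> by (simp add: v zero_prod_def)
    moreover have "coeff p d \<noteq> 0 \<or> coeff q d \<noteq> 0"
      using assms(2,3) by (cases "degree p \<le> degree q") (auto simp: max_def)
    ultimately show ?thesis
      using True assms(2)
      by (auto simp: v lifted_map_def project_def quotient_map_def homogenize_0 zero_prod_def Let_def)
  qed
  then show "lifted_map d p q v \<noteq> 0" "project (lifted_map d p q v) = quotient_map p q (project v)"
    by auto
qed

section \<open>Equality of Fubini-Study distances as a polynomial equation\<close>

lemma d_FS_origin_project:
  assumes "v \<noteq> 0"
  shows "d_FS_origin (project v)
    = 2 / pi * arccos (sqrt ((cmod (snd v))\<^sup>2 / ((cmod (fst v))\<^sup>2 + (cmod (snd v))\<^sup>2)))"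
proof (cases "snd v = 0")
  case False
  then have "1 / (1 + (cmod (fst v / snd v))\<^sup>2)
      = (cmod (snd v))\<^sup>2 / ((cmod (fst v))\<^sup>2 + (cmod (snd v))\<^sup>2)"
    by (simp add: norm_divide power_divide field_simps)
  then show ?thesis
    using False by (simp add: project_def d_FS_origin_def)
\<comment> \<open>At infinity the fraction is 0 and \<open>arccos 0 = pi / 2\<close>, which gives
  the prescribed value 1.\<close>
qed (simp add: project_def d_FS_origin_def)

text \<open>Equality of the moduli of the two quotients with denominators cleared, which covers
  infinity too. Squared moduli appear as products with conjugates, so that the left-hand side is a
  polynomial expression.\<close>

lemma d_FS_origin_project_eq_iff:
  assumes "v \<noteq> 0" "v' \<noteq> 0"
  shows "d_FS_origin (project v) = d_FS_origin (project v') \<longleftrightarrow>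
    fst v * cnj (fst v) * (snd v' * cnj (snd v')) - fst v' * cnj (fst v') * (snd v * cnj (snd v)) = 0"
proof -
  define a b a' b' where "a = (cmod (fst v))\<^sup>2" and "b = (cmod (snd v))\<^sup>2"
    and "a' = (cmod (fst v'))\<^sup>2" and "b' = (cmod (snd v'))\<^sup>2"
  note defs = a_def b_def a'_def b'_def
  have nonneg: "a \<ge> 0" "b \<ge> 0" "a' \<ge> 0" "b' \<ge> 0"
    by (auto simp: defs)
  have pos: "a + b > 0" "a' + b' > 0"
    using assms by (auto simp: defs sum_power2_gt_zero_iff zero_prod_def prod_eq_iff)
  have range: "sqrt (b / (a + b)) \<le> 1" "sqrt (b' / (a' + b')) \<le> 1"
    "sqrt (b / (a + b)) \<ge> 0" "sqrt (b' / (a' + b')) \<ge> 0"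
    using nonneg pos by (auto simp: field_simps)
  have "d_FS_origin (project v) = d_FS_origin (project v') \<longleftrightarrow>
      arccos (sqrt (b / (a + b))) = arccos (sqrt (b' / (a' + b')))"
    using assms by (simp add: d_FS_origin_project defs)
  also have "\<dots> \<longleftrightarrow> sqrt (b / (a + b)) = sqrt (b' / (a' + b'))"
    using range by (intro arccos_eq_iff) auto
  \<comment> \<open>Cross-multiplying gives \<open>b * (a' + b') = b' * (a + b)\<close>, where
    \<open>b * b'\<close> cancels.\<close>
  also have "\<dots> \<longleftrightarrow> a * b' = a' * b"
    using pos by (auto simp: frac_eq_eq algebra_simps)
  also have "\<dots> \<longleftrightarrow> complex_of_real (a * b') = complex_of_real (a' * b)"
    by (simp only: of_real_eq_iff)
  finally show ?thesis
    by (simp add: defs complex_norm_square del: of_real_power)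
qed

section \<open>Pairs of orbits and their polynomial equations\<close>

theorem lemma1:
  fixes R :: "riemann_sphere \<Rightarrow> riemann_sphere" and d :: nat
  assumes "rational_map_of_degree d R" and "d \<ge> 2"
  shows "\<exists>N::nat. \<forall>z0 w0 :: riemann_sphere.
           (\<forall>n\<le>N. d_FS_origin ((R ^^ n) z0) = d_FS_origin ((R ^^ n) w0)) \<longrightarrow>
           (\<forall>n. d_FS_origin ((R ^^ n) z0) = d_FS_origin ((R ^^ n) w0))"
proof -
  obtain p q where pq: "q \<noteq> 0" "coprime p q" "d = max (degree p) (degree q)"
    and R: "R = quotient_map p q"
    using assms(1) unfolding rational_map_of_degree_def by blast
  \<comment> \<open>The lifted orbit is never rescaled, so its coordinates remain polynomial in
    those of the initial lift.\<close>
  define L where "L n z = (lifted_map d p q ^^ n) (lift_to_C2 z)" for n z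
  have L: "L n z \<noteq> 0 \<and> project (L n z) = (R ^^ n) z" for n z
    by (induction n) (simp_all add: L_def R lift_nonzero project_lift lifted_map_correct pq)
  have L_Suc: "fst (L (Suc n) z) = homogenize d p (fst (L n z)) (snd (L n z))"
    "snd (L (Suc n) z) = homogenize d q (fst (L n z)) (snd (L n z))" for n z
    by (simp_all add: L_def lifted_map_def)
  \<comment> \<open>Eight generators: both coordinates of the chosen lift, and their conjugates, for
    each point of the pair.\<close>
  define coords :: "(riemann_sphere \<times> riemann_sphere \<Rightarrow> complex) list" where
    "coords = [\<lambda>x. fst (L 0 (fst x)), \<lambda>x. snd (L 0 (fst x)),
      \<lambda>x. cnj (fst (L 0 (fst x))), \<lambda>x. cnj (snd (L 0 (fst x))),
      \<lambda>x. fst (L 0 (snd x)), \<lambda>x. snd (L 0 (snd x)),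
      \<lambda>x. cnj (fst (L 0 (snd x))), \<lambda>x. cnj (snd (L 0 (snd x)))]"
  define A where "A = polynomial_functions coords"
  \<comment> \<open>The variable \<open>\<pi>\<close> lets one induction treat both points. All four
    memberships go together since each new coordinate uses both old ones.\<close>
  have L_poly: "(\<lambda>x. fst (L n (\<pi> x))) \<in> A \<and> (\<lambda>x. snd (L n (\<pi> x))) \<in> A \<and>
      (\<lambda>x. cnj (fst (L n (\<pi> x)))) \<in> A \<and> (\<lambda>x. cnj (snd (L n (\<pi> x)))) \<in> A"
    if "\<pi> = fst \<or> \<pi> = snd" for n and \<pi> :: "riemann_sphere \<times> riemann_sphere \<Rightarrow> riemann_sphere"
  proof (induction n)
    case 0
    show ?case
      unfolding A_def using that
      by (intro conjI generator_polynomial_function) (auto simp: coords_def)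
  next
    case (Suc n)
    then show ?case
      unfolding L_Suc cnj_homogenize A_def by (intro conjI homogenize_polynomial_function) auto
  qed
  \<comment> \<open>This is the expression from \<open>d_FS_origin_project_eq_iff\<close> for the
    lifted orbits of \<open>z\<close> and \<open>w\<close> at time \<open>n\<close>.\<close>
  define f where "f n x = fst (L n (fst x)) * cnj (fst (L n (fst x))) *
      (snd (L n (snd x)) * cnj (snd (L n (snd x)))) -
      fst (L n (snd x)) * cnj (fst (L n (snd x))) *
      (snd (L n (fst x)) * cnj (snd (L n (fst x))))" for n x
  have f_iff: "d_FS_origin ((R ^^ n) z) = d_FS_origin ((R ^^ n) w) \<longleftrightarrow> f n (z, w) = 0" for n z w
    using d_FS_origin_project_eq_iff[of "L n z" "L n w"] L by (simp add: f_def)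
  have "f n \<in> A" for n
    unfolding f_def using L_poly[of fst n] L_poly[of snd n] unfolding A_def
    by (intro polynomial_function_intros) auto
  then obtain N where "\<forall>x. (\<forall>n\<le>N. f n x = 0) \<longrightarrow> (\<forall>n. f n x = 0)"
    using zero_sets_stabilise[of A f] unfolding A_def
    by (auto simp: subring_polynomial_functions noetherian_polynomial_functions)
  then show ?thesis
    unfolding f_iff by blast
qed

end
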